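(* The following hold, where all measures are Borel probability measures on $\mathbb{R}_{\ge0}=[0,\infty)$. (1) If $(\sigma_1\lor\sigma_2,\mu)\in\mathcal{Q}$, then $(\sigma_i,\mu)\in\mathcal{Q}$ for $i=1,2$. If in addition $(\sigma_1,\mathbb{U}^\lor_{\sigma_2}(\mu))\in\mathcal{Q}$, then $(\mathbb{U}^\lor_{\sigma_1}\circ\mathbb{U}^\lor_{\sigma_2})(\mu)=\mathbb{U}^\lor_{\sigma_1\lor\sigma_2}(\mu)$. (2) If $(\sigma,\mu_1),(\sigma,\mu_2)\in\mathcal{Q}$, then $\mathbb{U}^\lor_\sigma(\mu_1\vee_{\mathrm{b}}\mu_2)=\mathbb{U}^\lor_\sigma(\mu_1)\vee_{\mathrm{b}}\mathbb{U}^\lor_\sigma(\mu_2)$. (3) If $(\sigma,\mu)\in\mathcal{Q}$ and $t\ge1$, then $\mathbb{U}^\lor_\sigma(\mu^{\vee_{\mathrm{b}}t})=\mathbb{U}^\lor_\sigma(\mu)^{\vee_{\mathrm{b}}t}$. (4) For any $\sigma$ with $\sigma(\{\alpha_\sigma\})=0$, we have $\sigma^{\vee_{\mathrm{b}}2}=\mathbb{U}^\lor_\sigma(\sigma)^{\vee_{\mathrm{f}}2}$. (In (2) and (3), the assertion includes that the left-hand sides are defined, i.e. that $(\sigma,\mu_1\vee_{\mathrm{b}}\mu_2)\in\mathcal{Q}$ and $(\sigma,\mu^{\vee_{\mathrm{b}}t})\in\mathcal{Q}$, respectively.)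
   Context: For a Borel probability measure $\mu$ on $\mathbb{R}$, $F_\mu(x):=\mu((-\infty,x])$ is its distribution function. Probability measures on $\mathbb{R}_{\ge0}$ are regarded as measures on $\mathbb{R}$ with $F_\mu(x)=0$ for $x<0$. Let $\mathcal{P}(\mathbb{R}_{\ge0})$ be the set of Borel probability measures on $\mathbb{R}_{\ge0}$. Max-convolutions: - Classical: $F_{\mu\lor\nu}(x):=F_\mu(x)F_\nu(x)$. - Free max-convolution power, for $t\ge1$: $F_{\mu^{\vee_{\mathrm{f}}t}}(x):=\max\{tF_\mu(x)-(t-1),0\}$. - Boolean, for $\mu,\nu\in\mathcal{P}(\mathbb{R}_{\ge0})$: $\mu\vee_{\mathrm{b}}\nu\in\mathcal{P}(\mathbb{R}_{\ge0})$ with $F_{\mu\vee_{\mathrm{b}}\nu}(x):=\frac{F_\mu(x)F_\nu(x)}{F_\mu(x)+F_\nu(x)-F_\mu(x)F_\nu(x)}$ for $x\ge0$, the value being $0$ if $F_\mu(x)=0$ or $F_\nu(x)=0$. - Boolean max-convolution power, for $\mu\in\mathcal{P}(\mathbb{R}_{\ge0})$ and $t>0$: $\mu^{\vee_{\mathrm{b}}t}\in\mathcal{P}(\mathbb{R}_{\ge0})$ with $F_{\mu^{\vee_{\mathrm{b}}t}}(x):=\frac{F_\mu(x)}{t-(t-1)F_\mu(x)}$ for $x\ge0$. For $\mu\in\mathcal{P}(\mathbb{R}_{\ge0})$ put $\alpha_\mu:=\sup\{x: F_\mu(x)=0\}\ge0$. Let $\mathcal{Q}$ be the set of pairs $(\sigma,\mu)\in\mathcal{P}(\mathbb{R}_{\ge0})^2$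 such that $F_\sigma/F_\mu$ is monotonically decreasing (non-strictly) on $(\alpha_\mu,\infty)$ and $\mu(\{\alpha_\mu\})=0$. For $(\sigma,\mu)\in\mathcal{Q}$, $\mathbb{U}^\lor_\sigma(\mu)$ is the probability measure on $\mathbb{R}_{\ge0}$ whose distribution function is $$F_{\mathbb{U}^\lor_\sigma(\mu)}(x)=\frac{F_\mu(x)}{F_\sigma(x)+F_\mu(x)-F_\sigma(x)F_\mu(x)}\ \text{ for } x>\alpha_\mu,\qquad F_{\mathbb{U}^\lor_\sigma(\mu)}(x)=0\ \text{ for } x<\alpha_\mu,$$ with the value at $x=\alpha_\mu$ determined by right-continuity. In particular, for $\sigma=\mu$, $F_{\mathbb{U}^\lor_\sigma(\sigma)}(x)=\frac{1}{2-F_\sigma(x)}$ for $x\ge\alpha_\sigma$ and $0$ for $x<\alpha_\sigma$. *)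

theory Defs
  imports "HOL-Probability.Probability"
begin

section \<open>Borel probability measures on the nonnegative reals\<close>

text \<open>They are regarded as measures on all of \<open>real\<close> that vanish on the negative half-line.\<close>

definition prob_nonneg :: "real measure set" where
  "prob_nonneg = {\<mu>. real_distribution \<mu> \<and> measure \<mu> {..<0} = 0}"

section \<open>Max-convolutions\<close>

text \<open>A measure is specified through its distribution function \<open>F\<close>: whenever \<open>F\<close> is a
  probability distribution function, \<open>interval_measure F\<close> is the Borel probability measure
  with \<open>cdf (interval_measure F) = F\<close>. That this applies to each \<open>F\<close> below is
  proved in the lemmas \<open>*_wf\<close>.\<close>

definition max_conv :: "real measure \<Rightarrow> real measure \<Rightarrow> real measure" where
  "max_conv \<mu> \<nu> = interval_measure (\<lambda>x. cdf \<mu> x * cdf \<nu> x)"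

definition free_max_power :: "real measure \<Rightarrow> real \<Rightarrow> real measure" where
  "free_max_power \<mu> t = interval_measure (\<lambda>x. max (t * cdf \<mu> x - (t - 1)) 0)"

definition bool_max_conv :: "real measure \<Rightarrow> real measure \<Rightarrow> real measure" where
  "bool_max_conv \<mu> \<nu> = interval_measure (\<lambda>x.
     if x < 0 \<or> cdf \<mu> x = 0 \<or> cdf \<nu> x = 0 then 0
     else cdf \<mu> x * cdf \<nu> x / (cdf \<mu> x + cdf \<nu> x - cdf \<mu> x * cdf \<nu> x))"

definition bool_max_power :: "real measure \<Rightarrow> real \<Rightarrow> real measure" where
  "bool_max_power \<mu> t = interval_measure (\<lambda>x.
     if x < 0 then 0 else cdf \<mu> x / (t - (t - 1) * cdf \<mu> x))"

section \<open>The class of admissible pairs and the operator\<close>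

definition left_end :: "real measure \<Rightarrow> real" where
  "left_end \<mu> = Sup {x. cdf \<mu> x = 0}"

definition Q_pairs :: "(real measure \<times> real measure) set" where
  "Q_pairs = {(\<sigma>, \<mu>). \<sigma> \<in> prob_nonneg \<and> \<mu> \<in> prob_nonneg \<and>
     antimono_on {left_end \<mu><..} (\<lambda>x. cdf \<sigma> x / cdf \<mu> x) \<and>
     measure \<mu> {left_end \<mu>} = 0}"

definition U_formula :: "real measure \<Rightarrow> real measure \<Rightarrow> real \<Rightarrow> real" where
  "U_formula \<sigma> \<mu> x = cdf \<mu> x / (cdf \<sigma> x + cdf \<mu> x - cdf \<sigma> x * cdf \<mu> x)"

text \<open>The value at \<open>left_end \<mu>\<close>, being determined by right-continuity, is the right-hand limit
  there; for \<open>(\<sigma>, \<mu>) \<in> Q_pairs\<close> it exists because \<open>U_formula \<sigma> \<mu>\<close> is nondecreasing and bounded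
  on \<open>{left_end \<mu><..}\<close>. It need not be \<open>0\<close>.\<close>

definition U_cdf :: "real measure \<Rightarrow> real measure \<Rightarrow> real \<Rightarrow> real" where
  "U_cdf \<sigma> \<mu> x =
     (if x < left_end \<mu> then 0
      else if x > left_end \<mu> then U_formula \<sigma> \<mu> x
      else Lim (at_right (left_end \<mu>)) (U_formula \<sigma> \<mu>))"

definition U_max :: "real measure \<Rightarrow> real measure \<Rightarrow> real measure" where
  "U_max \<sigma> \<mu> = interval_measure (U_cdf \<sigma> \<mu>)"

section \<open>The measures above have the prescribed distribution functions\<close>

lemma prob_nonnegD:
  assumes "\<mu> \<in> prob_nonneg"
  shows "real_distribution \<mu>" "x < 0 \<Longrightarrow> cdf \<mu> x = 0" "mono (cdf \<mu>)"
    "0 \<le> cdf \<mu> x" "cdf \<mu> x \<le> 1" "continuous (at_right a) (cdf \<mu>)" "(cdf \<mu> \<longlongrightarrow> 1) at_top"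
proof -
  show rd: "real_distribution \<mu>" using assms by (simp add: prob_nonneg_def)
  interpret real_distribution \<mu> by fact
  show "cdf \<mu> x = 0" if "x < 0"
  proof -
    have "measure \<mu> {..x} \<le> measure \<mu> {..<0}"
      using that by (intro finite_measure_mono) auto
    then show ?thesis using assms
      by (simp add: prob_nonneg_def cdf_def measure_le_0_iff)
  qed
  show "mono (cdf \<mu>)" by (simp add: cdf_nondecreasing monoI)
  show "0 \<le> cdf \<mu> x" by (rule cdf_nonneg)
  show "cdf \<mu> x \<le> 1" by (rule cdf_bounded_prob)
  show "continuous (at_right a) (cdf \<mu>)" by (rule cdf_is_right_cont)
  show "(cdf \<mu> \<longlongrightarrow> 1) at_top" by (rule cdf_lim_at_top_prob)
qed

lemma interval_measure_prob_nonneg: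
  assumes "mono F" "\<And>a. continuous (at_right a) F" "\<And>x. x < 0 \<Longrightarrow> F x = 0" "(F \<longlongrightarrow> 1) at_top"
  shows "interval_measure F \<in> prob_nonneg" "cdf (interval_measure F) = F"
proof -
  have bot: "(F \<longlongrightarrow> 0) at_bot"
    by (rule tendsto_eventually, rule eventually_at_bot_dense[THEN iffD2]) (use assms(3) in blast)
  show c: "cdf (interval_measure F) = F"
    by (rule cdf_interval_measure) (use assms bot in \<open>auto simp: mono_def\<close>)
  have rd: "real_distribution (interval_measure F)"
    by (rule real_distribution_interval_measure) (use assms bot in \<open>auto simp: mono_def\<close>)
  interpret real_distribution "interval_measure F" by fact
  have "(F \<longlongrightarrow> measure (interval_measure F) {..<0}) (at_left 0)"
    using cdf_at_left[of 0] c by simp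
  moreover have "(F \<longlongrightarrow> 0) (at_left 0)"
    by (rule tendsto_eventually) (auto simp: eventually_at_filter assms(3))
  ultimately have "measure (interval_measure F) {..<0} = 0"
    using tendsto_unique trivial_limit_at_left_real by blast
  with rd show "interval_measure F \<in> prob_nonneg" by (simp add: prob_nonneg_def)
qed

lemma left_end_props:
  assumes "\<mu> \<in> prob_nonneg"
  shows "0 \<le> left_end \<mu>" "x < left_end \<mu> \<Longrightarrow> cdf \<mu> x = 0" "left_end \<mu> < x \<Longrightarrow> 0 < cdf \<mu> x"
proof -
  note D = prob_nonnegD[OF assms]
  let ?Z = "{x. cdf \<mu> x = 0}"
  have "\<forall>\<^sub>F x in at_top. 0 < cdf \<mu> x"
    using order_tendstoD(1)[OF D(7), of 0] by simp
  from eventually_happens[OF this] obtain b where b: "0 < cdf \<mu> b"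
    by auto
  have bdd: "bdd_above ?Z"
  proof (rule bdd_aboveI)
    fix x assume "x \<in> ?Z"
    then show "x \<le> b" using b monoD[OF D(3), of b x] by (cases "x \<le> b") simp_all
  qed
  have neg: "x < 0 \<Longrightarrow> x \<le> left_end \<mu>" for x
    unfolding left_end_def by (rule cSup_upper[OF _ bdd]) (simp add: D(2))
  show "0 \<le> left_end \<mu>"
    by (rule dense_le) (rule neg)
  show "cdf \<mu> x = 0" if "x < left_end \<mu>"
  proof -
    have "-1 \<in> ?Z" using D(2)[of "-1"] by simp
    then have "?Z \<noteq> {}" by (metis empty_iff)
    from less_cSupD[OF this that[unfolded left_end_def]]
    obtain z where "z \<in> ?Z" "x < z" by (elim bexE)
    then show ?thesis using monoD[OF D(3), of x z] D(4)[of x] by simp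
  qed
  show "0 < cdf \<mu> x" if "left_end \<mu> < x"
  proof (rule ccontr)
    assume "\<not> 0 < cdf \<mu> x"
    then have "x \<in> ?Z" using D(4)[of x] by auto
    then have "x \<le> left_end \<mu>" unfolding left_end_def by (rule cSup_upper[OF _ bdd])
    with that show False by simp
  qed
qed

lemma U_max_wf:
  assumes "(\<sigma>, \<mu>) \<in> Q_pairs"
  shows "U_max \<sigma> \<mu> \<in> prob_nonneg" "cdf (U_max \<sigma> \<mu>) = U_cdf \<sigma> \<mu>"
proof -
  have s: "\<sigma> \<in> prob_nonneg" and m: "\<mu> \<in> prob_nonneg"
    and anti: "antimono_on {left_end \<mu><..} (\<lambda>x. cdf \<sigma> x / cdf \<mu> x)"
    using assms by (auto simp: Q_pairs_def)
  note S = prob_nonnegD[OF s] and M = prob_nonnegD[OF m] and L = left_end_props[OF m]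
  define a where "a = left_end \<mu>"
  let ?f = "U_formula \<sigma> \<mu>"
  let ?D = "\<lambda>x. cdf \<sigma> x + cdf \<mu> x - cdf \<sigma> x * cdf \<mu> x"
  have Dpos: "0 < ?D x" if "a < x" for x
  proof -
    have "0 < cdf \<mu> x" using L(3) that by (simp add: a_def)
    moreover have "0 \<le> cdf \<sigma> x * (1 - cdf \<mu> x)" using S(4) M(5) by simp
    ultimately show ?thesis by (simp add: algebra_simps)
  qed
  have f_nonneg: "0 \<le> ?f x" if "a < x" for x
    using Dpos[OF that] M(4) by (simp add: U_formula_def)
  have f_le: "?f x \<le> ?f y" if "a < x" "x \<le> y" for x y
  proof -
    have p: "0 < cdf \<mu> x" "0 < cdf \<mu> y" using L(3) that by (auto simp: a_def)
    have eq: "?f z = 1 / (cdf \<sigma> z / cdf \<mu> z + (1 - cdf \<sigma> z))" if "0 < cdf \<mu> z" for z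
    proof -
      have "cdf \<sigma> z / cdf \<mu> z + (1 - cdf \<sigma> z) = ?D z / cdf \<mu> z"
        using that by (simp add: field_simps)
      then show ?thesis by (simp add: U_formula_def)
    qed
    have "cdf \<sigma> y / cdf \<mu> y \<le> cdf \<sigma> x / cdf \<mu> x"
      using anti that by (auto simp: monotone_on_def a_def)
    moreover have "cdf \<sigma> x \<le> cdf \<sigma> y" using monoD[OF S(3)] that by simp
    moreover have "0 < cdf \<sigma> y / cdf \<mu> y + (1 - cdf \<sigma> y)"
    proof -
      have "cdf \<sigma> y / cdf \<mu> y + (1 - cdf \<sigma> y) = ?D y / cdf \<mu> y"
        using p by (simp add: field_simps)
      then show ?thesis using Dpos[of y] p that by simp
    qed
    ultimately show ?thesis unfolding eq[OF p(1)] eq[OF p(2)]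
      by (intro divide_left_mono) (auto intro!: mult_pos_pos)
  qed
  define l where "l = Inf (?f ` {a<..})"
  have bdd: "bdd_below (?f ` {a<..})"
    by (rule bdd_belowI2[of _ 0]) (simp add: f_nonneg)
  have l_le: "l \<le> ?f x" if "a < x" for x
    unfolding l_def using that by (intro cInf_lower bdd) auto
  have l_nonneg: "0 \<le> l"
    unfolding l_def by (rule cInf_greatest) (auto simp: f_nonneg)
  have lim: "(?f \<longlongrightarrow> l) (at_right a)"
  proof (rule order_tendstoI)
    fix y assume "y < l"
    then show "\<forall>\<^sub>F x in at_right a. y < ?f x"
      unfolding eventually_at_filter
      by (intro always_eventually allI impI) (use l_le less_le_trans in force)
  next
    fix y assume "l < y"
    then obtain z where z: "a < z" "?f z < y"
      unfolding l_def using cInf_lessD[of "?f ` {a<..}" y] by auto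
    have "?f x < y" if "a < x" "x < z" for x
      using f_le[of x z] that z(2) by linarith
    then show "\<forall>\<^sub>F x in at_right a. ?f x < y"
      using z(1) unfolding eventually_at_right_field by blast
  qed
  have Lim: "Lim (at_right a) ?f = l"
    by (rule tendsto_Lim[OF _ lim]) simp
  have U: "U_cdf \<sigma> \<mu> x = (if x < a then 0 else if a < x then ?f x else l)" for x
    using Lim by (simp add: U_cdf_def a_def)
  have mono: "mono (U_cdf \<sigma> \<mu>)"
    by (rule monoI) (auto simp: U l_nonneg f_nonneg l_le f_le)
  have rc: "continuous (at_right x) (U_cdf \<sigma> \<mu>)" for x
  proof -
    consider "x < a" | "x = a" | "a < x" by linarith
    then show ?thesis
    proof cases
      case 1
      have "(U_cdf \<sigma> \<mu> \<longlongrightarrow> 0) (at_right x)"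
        by (rule tendsto_eventually) (use 1 in \<open>auto simp: eventually_at_right_field U intro!: exI[of _ a]\<close>)
      with 1 show ?thesis by (simp add: continuous_within U)
    next
      case 2
      have "(U_cdf \<sigma> \<mu> \<longlongrightarrow> l) (at_right a)"
        by (rule tendsto_cong[THEN iffD1, OF _ lim]) (auto simp: eventually_at_filter U)
      with 2 show ?thesis by (simp add: continuous_within U)
    next
      case 3
      have "(?f \<longlongrightarrow> ?f x) (at_right x)"
        using S(6)[of x] M(6)[of x] Dpos[OF 3] unfolding U_formula_def continuous_within
        by (intro tendsto_intros) auto
      then have "(U_cdf \<sigma> \<mu> \<longlongrightarrow> ?f x) (at_right x)"
        by (rule tendsto_cong[THEN iffD1, rotated])
           (use 3 in \<open>auto simp: eventually_at_filter U\<close>)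
      with 3 show ?thesis by (simp add: continuous_within U)
    qed
  qed
  have "(?f \<longlongrightarrow> 1 / (1 + 1 - 1 * 1)) at_top"
    unfolding U_formula_def by (intro tendsto_intros S(7) M(7)) simp
  then have "(?f \<longlongrightarrow> 1) at_top" by simp
  then have top: "(U_cdf \<sigma> \<mu> \<longlongrightarrow> 1) at_top"
    by (rule tendsto_cong[THEN iffD1, rotated])
       (auto simp: U intro: eventually_mono[OF eventually_gt_at_top[of a]])
  have neg: "U_cdf \<sigma> \<mu> x = 0" if "x < 0" for x
    using that L(1) by (simp add: U a_def)
  show "U_max \<sigma> \<mu> \<in> prob_nonneg" "cdf (U_max \<sigma> \<mu>) = U_cdf \<sigma> \<mu>"
    using interval_measure_prob_nonneg[OF mono rc neg top] by (simp_all only: U_max_def)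
qed

lemma max_conv_wf:
  assumes "\<mu> \<in> prob_nonneg" "\<nu> \<in> prob_nonneg"
  shows "max_conv \<mu> \<nu> \<in> prob_nonneg" "cdf (max_conv \<mu> \<nu>) = (\<lambda>x. cdf \<mu> x * cdf \<nu> x)"
proof -
  note M = prob_nonnegD[OF assms(1)] and N = prob_nonnegD[OF assms(2)]
  let ?F = "\<lambda>x. cdf \<mu> x * cdf \<nu> x"
  have mono: "mono ?F" by (intro monoI mult_mono monoD[OF M(3)] monoD[OF N(3)] M(4) N(4))
  have rc: "continuous (at_right a) ?F" for a by (intro continuous_intros M(6) N(6))
  have neg: "?F x = 0" if "x < 0" for x using M(2) that by simp
  have top: "(?F \<longlongrightarrow> 1) at_top" using tendsto_mult[OF M(7) N(7)] by simp
  show "max_conv \<mu> \<nu> \<in> prob_nonneg" "cdf (max_conv \<mu> \<nu>) = ?F"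
    using interval_measure_prob_nonneg[OF mono rc neg top] by (simp_all only: max_conv_def)
qed

lemma free_max_power_wf:
  assumes "\<mu> \<in> prob_nonneg" "1 \<le> t"
  shows "free_max_power \<mu> t \<in> prob_nonneg"
    "cdf (free_max_power \<mu> t) = (\<lambda>x. max (t * cdf \<mu> x - (t - 1)) 0)"
proof -
  note M = prob_nonnegD[OF assms(1)]
  let ?F = "\<lambda>x. max (t * cdf \<mu> x - (t - 1)) 0"
  have mono: "mono ?F"
    by (intro monoI max.mono diff_right_mono mult_left_mono monoD[OF M(3)]) (use assms(2) in auto)
  have rc: "continuous (at_right a) ?F" for a
    using M(6)[of a] unfolding continuous_within by (intro tendsto_intros) auto
  have neg: "?F x = 0" if "x < 0" for x using M(2) that assms(2) by simp
  have "(?F \<longlongrightarrow> max (t * 1 - (t - 1)) 0) at_top" by (intro tendsto_intros M(7))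
  then have top: "(?F \<longlongrightarrow> 1) at_top" by simp
  show "free_max_power \<mu> t \<in> prob_nonneg" "cdf (free_max_power \<mu> t) = ?F"
    using interval_measure_prob_nonneg[OF mono rc neg top] by (simp_all only: free_max_power_def)
qed

lemma bool_max_power_wf:
  assumes "\<mu> \<in> prob_nonneg" "0 < t"
  shows "bool_max_power \<mu> t \<in> prob_nonneg"
    "cdf (bool_max_power \<mu> t) = (\<lambda>x. cdf \<mu> x / (t - (t - 1) * cdf \<mu> x))"
proof -
  note M = prob_nonnegD[OF assms(1)]
  let ?F = "\<lambda>x. cdf \<mu> x / (t - (t - 1) * cdf \<mu> x)"
  have eq: "(\<lambda>x. if x < 0 then 0 else ?F x) = ?F" using M(2) by (auto simp: fun_eq_iff)
  have pos: "0 < t - (t - 1) * cdf \<mu> x" for x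
  proof (cases "cdf \<mu> x = 0")
    case False
    then have "0 < cdf \<mu> x" using M(4)[of x] by simp
    moreover have "0 \<le> t * (1 - cdf \<mu> x)" using assms(2) M(5)[of x] by simp
    ultimately show ?thesis by (simp add: algebra_simps)
  qed (use assms in simp)
  have "?F x \<le> ?F y" if "x \<le> y" for x y
  proof -
    have "t * cdf \<mu> x \<le> t * cdf \<mu> y" using monoD[OF M(3) that] assms(2) by simp
    then show ?thesis using pos[of x] pos[of y] by (simp add: divide_simps algebra_simps)
  qed
  then have mono: "mono ?F" by (rule monoI)
  have rc: "continuous (at_right a) ?F" for a
    using M(6)[of a] pos[of a] unfolding continuous_within by (intro tendsto_intros) auto
  have neg: "?F x = 0" if "x < 0" for x using M(2) that by simp
  have "(?F \<longlongrightarrow> 1 / (t - (t - 1) * 1)) at_top" by (intro tendsto_intros M(7)) simp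
  then have top: "(?F \<longlongrightarrow> 1) at_top" by simp
  show "bool_max_power \<mu> t \<in> prob_nonneg" "cdf (bool_max_power \<mu> t) = ?F"
    using interval_measure_prob_nonneg[OF mono rc neg top] by (simp_all only: bool_max_power_def eq)
qed

lemma bool_max_conv_wf:
  assumes "\<mu> \<in> prob_nonneg" "\<nu> \<in> prob_nonneg"
  shows "bool_max_conv \<mu> \<nu> \<in> prob_nonneg"
    "cdf (bool_max_conv \<mu> \<nu>) = (\<lambda>x. if cdf \<mu> x = 0 \<or> cdf \<nu> x = 0 then 0
       else cdf \<mu> x * cdf \<nu> x / (cdf \<mu> x + cdf \<nu> x - cdf \<mu> x * cdf \<nu> x))"
proof -
  note M = prob_nonnegD[OF assms(1)] and N = prob_nonnegD[OF assms(2)]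
  let ?m = "cdf \<mu>" and ?n = "cdf \<nu>"
  let ?F = "\<lambda>x. if ?m x = 0 \<or> ?n x = 0 then 0 else ?m x * ?n x / (?m x + ?n x - ?m x * ?n x)"
  have eq: "(\<lambda>x. if x < 0 \<or> ?m x = 0 \<or> ?n x = 0 then 0
      else ?m x * ?n x / (?m x + ?n x - ?m x * ?n x)) = ?F"
    using M(2) by (auto simp: fun_eq_iff)
  have pos: "0 < ?m x + ?n x - ?m x * ?n x" if "?m x \<noteq> 0 \<or> ?n x \<noteq> 0" for x
  proof -
    have a: "0 \<le> ?n x * (1 - ?m x)" "0 \<le> ?m x * (1 - ?n x)"
      using M(4,5)[of x] N(4,5)[of x] by auto
    from that show ?thesis
    proof
      assume "?m x \<noteq> 0"
      then have "0 < ?m x" using M(4)[of x] by simp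
      with a(1) show ?thesis by (simp add: algebra_simps)
    next
      assume "?n x \<noteq> 0"
      then have "0 < ?n x" using N(4)[of x] by simp
      with a(2) show ?thesis by (simp add: algebra_simps)
    qed
  qed
  have nn: "0 \<le> ?F x" for x using pos[of x] M(4)[of x] N(4)[of x] by auto
  have le_m: "?F x \<le> ?m x" for x
  proof (cases "?m x = 0 \<or> ?n x = 0")
    case False
    have "?n x \<le> ?m x + ?n x - ?m x * ?n x"
      using mult_left_mono[OF N(5)[of x] M(4)[of x]] by simp
    then have "?m x * ?n x \<le> ?m x * (?m x + ?n x - ?m x * ?n x)"
      by (rule mult_left_mono) (rule M(4))
    then show ?thesis using False pos[of x] by (simp add: pos_divide_le_eq)
  qed (use M(4) in auto)
  have le_n: "?F x \<le> ?n x" for x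
  proof (cases "?m x = 0 \<or> ?n x = 0")
    case False
    have "?m x \<le> ?m x + ?n x - ?m x * ?n x"
      using mult_right_mono[OF M(5)[of x] N(4)[of x]] by simp
    then have "?n x * ?m x \<le> ?n x * (?m x + ?n x - ?m x * ?n x)"
      by (rule mult_left_mono) (rule N(4))
    then show ?thesis using False pos[of x] by (simp add: pos_divide_le_eq mult.commute)
  qed (use N(4) in auto)
  have "?F x \<le> ?F y" if xy: "x \<le> y" for x y
  proof (cases "?m x = 0 \<or> ?n x = 0")
    case True
    then have "?F x = 0" by simp
    then show ?thesis using nn[of y] by linarith
  next
    case False
    then have p: "0 < ?m x" "0 < ?n x" using M(4)[of x] N(4)[of x] by auto
    have le: "?m x \<le> ?m y" "?n x \<le> ?n y" using monoD[OF M(3) xy] monoD[OF N(3) xy] by auto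
    have inv: "?F z = inverse (1 / ?m z + 1 / ?n z - 1)" if "0 < ?m z" "0 < ?n z" for z
    proof -
      have "1 / ?m z + 1 / ?n z - 1 = (?m z + ?n z - ?m z * ?n z) / (?m z * ?n z)"
        using that by (simp add: field_simps)
      then show ?thesis using that by simp
    qed
    have q: "0 < ?m y" "0 < ?n y" using p le by linarith+
    have "1 / ?m y \<le> 1 / ?m x" "1 / ?n y \<le> 1 / ?n x"
      using p le by (auto intro!: divide_left_mono mult_pos_pos q)
    moreover have "1 \<le> 1 / ?m y" "0 < 1 / ?n y" using M(5)[of y] q by auto
    ultimately have "1 / ?m y + 1 / ?n y - 1 \<le> 1 / ?m x + 1 / ?n x - 1"
      "0 < 1 / ?m y + 1 / ?n y - 1" by linarith+
    then show ?thesis unfolding inv[OF p] inv[OF q] by (rule le_imp_inverse_le)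
  qed
  then have mono: "mono ?F" by (rule monoI)
  have rc: "continuous (at_right a) ?F" for a
  proof (cases "?m a = 0 \<or> ?n a = 0")
    case True
    have "(?F \<longlongrightarrow> 0) (at_right a)"
    proof (cases "?m a = 0")
      case True
      have lim: "(?m \<longlongrightarrow> 0) (at_right a)" using M(6)[of a] True by (simp add: continuous_within)
      show ?thesis
        by (rule tendsto_sandwich[OF _ _ tendsto_const lim])
           (intro always_eventually allI nn le_m)+
    next
      case False
      then have "?n a = 0" using \<open>?m a = 0 \<or> ?n a = 0\<close> by simp
      then have lim: "(?n \<longlongrightarrow> 0) (at_right a)" using N(6)[of a] by (simp add: continuous_within)
      show ?thesis
        by (rule tendsto_sandwich[OF _ _ tendsto_const lim])
           (intro always_eventually allI nn le_n)+
    qed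
    then show ?thesis using True by (simp add: continuous_within)
  next
    case False
    let ?G = "\<lambda>x. ?m x * ?n x / (?m x + ?n x - ?m x * ?n x)"
    have "(?G \<longlongrightarrow> ?G a) (at_right a)"
      using M(6)[of a] N(6)[of a] pos[of a] False unfolding continuous_within
      by (intro tendsto_intros) auto
    moreover have "?F = ?G" by (auto simp: fun_eq_iff)
    ultimately show ?thesis by (simp only: continuous_within)
  qed
  have neg: "?F x = 0" if "x < 0" for x using M(2) that by simp
  have top: "(?F \<longlongrightarrow> 1) at_top"
  proof -
    have "((\<lambda>x. ?m x * ?n x / (?m x + ?n x - ?m x * ?n x)) \<longlongrightarrow> 1 * 1 / (1 + 1 - 1 * 1)) at_top"
      by (intro tendsto_intros M(7) N(7)) simp
    moreover have "?F = (\<lambda>x. ?m x * ?n x / (?m x + ?n x - ?m x * ?n x))"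
      by (auto simp: fun_eq_iff)
    ultimately show ?thesis by simp
  qed
  show "bool_max_conv \<mu> \<nu> \<in> prob_nonneg" "cdf (bool_max_conv \<mu> \<nu>) = ?F"
    using interval_measure_prob_nonneg[OF mono rc neg top] by (simp_all only: bool_max_conv_def eq)
qed

end

theory Submission
  imports Defs
begin

text \<open>
  The substitution \<open>p \<mapsto> (1 - p) / p\<close> sends the distribution functions to
  "odds against", a nonnegative quantity in which the Boolean operations and \<open>U_max\<close> are
  linear at each point \<open>x\<close>: the Boolean max-convolution adds the odds,
  the Boolean power with exponent \<open>t\<close> multiplies them by the constant \<open>t\<close>, and \<open>U_max \<sigma>\<close>
  multiplies them by \<open>cdf \<sigma> x\<close>:
    \<open>1 / F - 1 = cdf \<sigma> x * (1 / cdf \<mu> x - 1)\<close> for \<open>F = U_formula \<sigma> \<mu> x\<close>.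
  Composing two such operators multiplies by \<open>cdf \<sigma>\<^sub>1 x * cdf \<sigma>\<^sub>2 x\<close>, which is the distribution
  function of \<open>max_conv \<sigma>\<^sub>1 \<sigma>\<^sub>2\<close>, and multiplication by \<open>cdf \<sigma> x\<close> distributes over addition and
  commutes with multiplication by \<open>t\<close>. For \<open>\<mu> = \<sigma>\<close> the product is \<open>1 - cdf \<sigma> x\<close>, so that
  \<open>U_max \<sigma> \<sigma>\<close> has the distribution function \<open>1 / (2 - cdf \<sigma> x)\<close>, on which the affine map of
  the free square can be evaluated directly.

  Since the odds are finite only where the distribution function is positive, this computation is
  available to the right of the left end point of the measure; to the left of it both sides vanish.
  At the end point itself the value of \<open>U_cdf\<close> is a limit that is never computed: two
  distribution functions that agree off one point agree there too, by right-continuity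
  (\<open>prob_nonneg_eqI_off_point\<close>).

  For membership in \<open>Q_pairs\<close>, the ratio \<open>cdf \<sigma> / F\<close> is, for each of the Boolean
  operations, a combination of
  antitone functions: the ratios for the given measures, with nonnegative coefficients, and
  \<open>- cdf \<sigma>\<close>. For the factors of a max-convolution one divides an antitone function by the
  monotone function of the other factor.
\<close>

section \<open>Distribution functions and left end points\<close>

lemma prob_nonneg_eqI_off_point:
  assumes "\<mu> \<in> prob_nonneg" "\<nu> \<in> prob_nonneg"
    and off: "\<And>x. x < a \<Longrightarrow> cdf \<mu> x = cdf \<nu> x" "\<And>x. a < x \<Longrightarrow> cdf \<mu> x = cdf \<nu> x"
  shows "\<mu> = \<nu>"
proof -
  note M = prob_nonnegD[OF assms(1)] and N = prob_nonnegD[OF assms(2)]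
  have "(cdf \<mu> \<longlongrightarrow> cdf \<mu> a) (at_right a)" "(cdf \<nu> \<longlongrightarrow> cdf \<nu> a) (at_right a)"
    using M(6)[of a] N(6)[of a] by (simp_all add: continuous_within)
  moreover have "\<forall>\<^sub>F x in at_right a. cdf \<mu> x = cdf \<nu> x"
    by (auto simp: eventually_at_filter off(2))
  ultimately have "cdf \<mu> a = cdf \<nu> a"
    using tendsto_cong tendsto_unique trivial_limit_at_right_real by metis
  with off have "cdf \<mu> x = cdf \<nu> x" for x
    by (cases x a rule: linorder_cases) auto
  then show ?thesis
    using cdf_unique[OF M(1) N(1)] by (simp add: fun_eq_iff)
qed

lemma left_end_eqI:
  assumes "\<mu> \<in> prob_nonneg" "\<And>x. x < a \<Longrightarrow> cdf \<mu> x = 0" "\<And>x. a < x \<Longrightarrow> 0 < cdf \<mu> x"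
  shows "left_end \<mu> = a"
proof (rule linorder_cases[of "left_end \<mu>" a])
  assume "left_end \<mu> < a"
  then obtain x where "left_end \<mu> < x" "x < a" using dense by blast
  then show ?thesis using left_end_props(3)[OF assms(1)] assms(2) by force
next
  assume "a < left_end \<mu>"
  then obtain x where "a < x" "x < left_end \<mu>" using dense by blast
  then show ?thesis using left_end_props(2)[OF assms(1)] assms(3) by force
qed

text \<open>The distribution function vanishes to the left of the left end point, so an atom there
  carries all the mass accumulated up to that point.\<close>

lemma measure_left_end:
  assumes "\<mu> \<in> prob_nonneg"
  shows "measure \<mu> {left_end \<mu>} = cdf \<mu> (left_end \<mu>)"
proof -
  let ?a = "left_end \<mu>"
  interpret real_distribution \<mu> by (rule prob_nonnegD(1)[OF assms])
  have "(cdf \<mu> \<longlongrightarrow> 0) (at_left ?a)"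
    by (rule tendsto_eventually)
       (auto simp: eventually_at_filter left_end_props(2)[OF assms])
  then have "measure \<mu> {..<?a} = 0"
    using cdf_at_left[of ?a] tendsto_unique trivial_limit_at_left_real by blast
  moreover have "measure \<mu> {..?a} = measure \<mu> {..<?a} + measure \<mu> {?a}"
    using finite_measure_Union[of "{..<?a}" "{?a}"] by (simp add: ivl_disj_un_singleton(2)[symmetric])
  ultimately show ?thesis by (simp add: cdf_def)
qed

lemma Q_pairsI:
  assumes "\<sigma> \<in> prob_nonneg" "\<mu> \<in> prob_nonneg" "left_end \<mu> = a" "cdf \<mu> a = 0"
    and "\<And>x y. a < x \<Longrightarrow> x \<le> y \<Longrightarrow> cdf \<sigma> y / cdf \<mu> y \<le> cdf \<sigma> x / cdf \<mu> x"
  shows "(\<sigma>, \<mu>) \<in> Q_pairs"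
  using assms measure_left_end[of \<mu>] by (auto simp: Q_pairs_def monotone_on_def)

lemma Q_pairsD:
  assumes "(\<sigma>, \<mu>) \<in> Q_pairs"
  shows "\<sigma> \<in> prob_nonneg" "\<mu> \<in> prob_nonneg" "cdf \<mu> (left_end \<mu>) = 0"
    "left_end \<mu> < x \<Longrightarrow> x \<le> y \<Longrightarrow> cdf \<sigma> y / cdf \<mu> y \<le> cdf \<sigma> x / cdf \<mu> x"
  using assms measure_left_end[of \<mu>] by (auto simp: Q_pairs_def monotone_on_def)

section \<open>Odds against\<close>

definition odds :: "real \<Rightarrow> real" where
  "odds p = (1 - p) / p"

lemma odds_divide: "0 < b \<Longrightarrow> odds (a / b) = (b - a) / a"
  by (cases "a = 0") (auto simp: odds_def field_simps)

lemma odds_inject: "0 < p \<Longrightarrow> 0 < q \<Longrightarrow> odds p = odds q \<longleftrightarrow> p = q"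
  by (simp add: odds_def field_simps)

lemma mult_odds: "0 < p \<Longrightarrow> s * odds p = s / p - s"
  by (simp add: odds_def field_simps)

text \<open>In terms of odds the operator \<open>U_max \<sigma>\<close> acts as multiplication by \<open>cdf \<sigma>\<close>. The left end
  point is preserved because finite odds stay finite.\<close>

lemma U_max_odds:
  assumes Q: "(\<sigma>, \<mu>) \<in> Q_pairs"
  shows "x < left_end \<mu> \<Longrightarrow> cdf (U_max \<sigma> \<mu>) x = 0"
    and "left_end \<mu> < x \<Longrightarrow> 0 < cdf (U_max \<sigma> \<mu>) x"
    and "left_end \<mu> < x \<Longrightarrow> odds (cdf (U_max \<sigma> \<mu>) x) = cdf \<sigma> x * odds (cdf \<mu> x)"
    and "left_end (U_max \<sigma> \<mu>) = left_end \<mu>"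
proof -
  note s = Q_pairsD(1)[OF Q] and m = Q_pairsD(2)[OF Q]
  let ?s = "cdf \<sigma>" and ?m = "cdf \<mu>"
  show zero: "cdf (U_max \<sigma> \<mu>) x = 0" if "x < left_end \<mu>" for x
    using that by (simp add: U_max_wf(2)[OF Q] U_cdf_def)
  have val: "0 < cdf (U_max \<sigma> \<mu>) x \<and> odds (cdf (U_max \<sigma> \<mu>) x) = ?s x * odds (?m x)"
    if x: "left_end \<mu> < x" for x
  proof -
    have p: "0 < ?m x" using left_end_props(3)[OF m x] .
    have "0 \<le> ?s x * (1 - ?m x)" using prob_nonnegD(4)[OF s] prob_nonnegD(5)[OF m] by simp
    with p have D: "0 < ?s x + ?m x - ?s x * ?m x" by (simp add: algebra_simps)
    have "cdf (U_max \<sigma> \<mu>) x = ?m x / (?s x + ?m x - ?s x * ?m x)"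
      using x by (simp add: U_max_wf(2)[OF Q] U_cdf_def U_formula_def)
    then show ?thesis using p D by (simp add: odds_divide) (simp add: odds_def algebra_simps)
  qed
  show pos: "0 < cdf (U_max \<sigma> \<mu>) x" if "left_end \<mu> < x" for x using val that by blast
  show "odds (cdf (U_max \<sigma> \<mu>) x) = ?s x * odds (?m x)" if "left_end \<mu> < x"
    using val that by blast
  show "left_end (U_max \<sigma> \<mu>) = left_end \<mu>"
    by (rule left_end_eqI[OF U_max_wf(1)[OF Q] zero pos])
qed

text \<open>A positive value of a distribution function is determined by its odds, and the value at the
  left end point of \<open>\<mu>\<close> follows by right-continuity. Each identity for \<open>U_max\<close> is reduced to
  arithmetic of odds in this way.\<close>

lemma eq_U_maxI:
  assumes Q: "(\<sigma>, \<mu>) \<in> Q_pairs" and n: "\<nu> \<in> prob_nonneg"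
    and "\<And>x. x < left_end \<mu> \<Longrightarrow> cdf \<nu> x = 0"
    and "\<And>x. left_end \<mu> < x \<Longrightarrow> 0 < cdf \<nu> x"
    and "\<And>x. left_end \<mu> < x \<Longrightarrow> odds (cdf \<nu> x) = cdf \<sigma> x * odds (cdf \<mu> x)"
  shows "\<nu> = U_max \<sigma> \<mu>"
proof (rule prob_nonneg_eqI_off_point[OF n U_max_wf(1)[OF Q], of "left_end \<mu>"])
  fix x
  show "cdf \<nu> x = cdf (U_max \<sigma> \<mu>) x" if "x < left_end \<mu>"
    using that assms(3) U_max_odds(1)[OF Q] by simp
  show "cdf \<nu> x = cdf (U_max \<sigma> \<mu>) x" if "left_end \<mu> < x"
    using that assms(4,5) U_max_odds(2,3)[OF Q] odds_inject by metis
qed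

section \<open>Composition of the operators\<close>

text \<open>A product \<open>cdf \<sigma> * cdf \<tau>\<close> over \<open>cdf \<mu>\<close> that is antitone cannot vanish on the ray, since it
  tends to \<open>1\<close>. Hence it may be divided by the monotone positive function \<open>cdf \<tau>\<close>, which leaves
  an antitone function.\<close>

lemma Q_pairs_max_conv_factor:
  assumes s: "\<sigma> \<in> prob_nonneg" and t: "\<tau> \<in> prob_nonneg" and Q: "(max_conv \<sigma> \<tau>, \<mu>) \<in> Q_pairs"
  shows "(\<sigma>, \<mu>) \<in> Q_pairs"
proof (rule Q_pairsI[OF s Q_pairsD(2)[OF Q] refl Q_pairsD(3)[OF Q]])
  note m = Q_pairsD(2)[OF Q]
  note S = prob_nonnegD[OF s] and T = prob_nonnegD[OF t] and M = prob_nonnegD[OF m]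
  let ?s = "cdf \<sigma>" and ?t = "cdf \<tau>" and ?m = "cdf \<mu>"
  have anti: "?s y * ?t y / ?m y \<le> ?s x * ?t x / ?m x" if "left_end \<mu> < x" "x \<le> y" for x y
    using Q_pairsD(4)[OF Q that] by (simp add: max_conv_wf(2)[OF s t])
  fix x y assume x: "left_end \<mu> < x" and xy: "x \<le> y"
  have mp: "0 < ?m x" "0 < ?m y" using left_end_props(3)[OF m] x xy by auto
  have lim: "((\<lambda>z. ?s z * ?t z / ?m z) \<longlongrightarrow> 1 * 1 / 1) at_top"
    by (intro tendsto_intros S(7) T(7) M(7)) simp
  have "1 * 1 / 1 \<le> ?s x * ?t x / ?m x"
    by (rule tendsto_upperbound[OF lim])
       (auto intro: eventually_mono[OF eventually_ge_at_top[of x]] anti[OF x])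
  then have "?t x \<noteq> 0" by auto
  then have tp: "0 < ?t x" using T(4)[of x] by simp
  have tle: "?t x \<le> ?t y" using monoD[OF T(3) xy] .
  have "(?s y / ?m y) * ?t x \<le> (?s y / ?m y) * ?t y"
    using tle S(4)[of y] mp by (intro mult_left_mono) auto
  also have "\<dots> \<le> (?s x / ?m x) * ?t x" using anti[OF x xy] by simp
  finally show "?s y / ?m y \<le> ?s x / ?m x" by (rule mult_right_le_imp_le[OF _ tp])
qed

lemma max_conv_commute: "max_conv \<mu> \<nu> = max_conv \<nu> \<mu>"
  by (simp add: max_conv_def mult.commute)

lemma U_max_max_conv:
  assumes s: "\<sigma>\<^sub>1 \<in> prob_nonneg" "\<sigma>\<^sub>2 \<in> prob_nonneg"
    and Q: "(max_conv \<sigma>\<^sub>1 \<sigma>\<^sub>2, \<mu>) \<in> Q_pairs" and Q2: "(\<sigma>\<^sub>2, \<mu>) \<in> Q_pairs"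
    and Q1: "(\<sigma>\<^sub>1, U_max \<sigma>\<^sub>2 \<mu>) \<in> Q_pairs"
  shows "U_max \<sigma>\<^sub>1 (U_max \<sigma>\<^sub>2 \<mu>) = U_max (max_conv \<sigma>\<^sub>1 \<sigma>\<^sub>2) \<mu>"
  using U_max_odds[OF Q1] U_max_odds[OF Q2]
  by (intro eq_U_maxI[OF Q U_max_wf(1)[OF Q1]]) (simp_all add: max_conv_wf(2)[OF s])

section \<open>Compatibility with the Boolean operations\<close>

lemma bool_max_conv_odds:
  assumes m: "\<mu> \<in> prob_nonneg" and n: "\<nu> \<in> prob_nonneg"
  shows "cdf \<mu> x = 0 \<or> cdf \<nu> x = 0 \<Longrightarrow> cdf (bool_max_conv \<mu> \<nu>) x = 0"
    and "0 < cdf \<mu> x \<Longrightarrow> 0 < cdf \<nu> x \<Longrightarrow> 0 < cdf (bool_max_conv \<mu> \<nu>) x"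
    and "0 < cdf \<mu> x \<Longrightarrow> 0 < cdf \<nu> x \<Longrightarrow>
      odds (cdf (bool_max_conv \<mu> \<nu>) x) = odds (cdf \<mu> x) + odds (cdf \<nu> x)"
proof -
  let ?m = "cdf \<mu> x" and ?n = "cdf \<nu> x"
  show "cdf (bool_max_conv \<mu> \<nu>) x = 0" if "?m = 0 \<or> ?n = 0"
    using that by (simp add: bool_max_conv_wf(2)[OF m n])
  assume p: "0 < ?m" "0 < ?n"
  have "?m * ?n \<le> 1 * ?n" using p prob_nonnegD(5)[OF m] by (intro mult_right_mono) auto
  with p have D: "0 < ?m + ?n - ?m * ?n" by linarith
  have F: "cdf (bool_max_conv \<mu> \<nu>) x = ?m * ?n / (?m + ?n - ?m * ?n)"
    using p by (simp add: bool_max_conv_wf(2)[OF m n])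
  show "0 < cdf (bool_max_conv \<mu> \<nu>) x" using F p D by simp
  show "odds (cdf (bool_max_conv \<mu> \<nu>) x) = odds ?m + odds ?n"
    using F p D by (simp add: odds_divide) (simp add: odds_def field_simps)
qed

lemma left_end_bool_max_conv:
  assumes "\<mu> \<in> prob_nonneg" "\<nu> \<in> prob_nonneg"
  shows "left_end (bool_max_conv \<mu> \<nu>) = max (left_end \<mu>) (left_end \<nu>)"
proof (rule left_end_eqI[OF bool_max_conv_wf(1)[OF assms]])
  fix x
  show "cdf (bool_max_conv \<mu> \<nu>) x = 0" if "x < max (left_end \<mu>) (left_end \<nu>)"
    using that left_end_props(2)[OF assms(1)] left_end_props(2)[OF assms(2)]
    by (intro bool_max_conv_odds(1)[OF assms]) (auto simp: less_max_iff_disj)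
  show "0 < cdf (bool_max_conv \<mu> \<nu>) x" if "max (left_end \<mu>) (left_end \<nu>) < x"
    using that left_end_props(3)[OF assms(1)] left_end_props(3)[OF assms(2)]
    by (intro bool_max_conv_odds(2)[OF assms]) auto
qed

text \<open>Adding odds turns the ratio for the convolution into
  \<open>cdf \<sigma> / cdf \<mu> + cdf \<sigma> / cdf \<nu> - cdf \<sigma>\<close>.\<close>

lemma Q_pairs_bool_max_conv:
  assumes Q1: "(\<sigma>, \<mu>) \<in> Q_pairs" and Q2: "(\<sigma>, \<nu>) \<in> Q_pairs"
  shows "(\<sigma>, bool_max_conv \<mu> \<nu>) \<in> Q_pairs"
proof -
  note s = Q_pairsD(1)[OF Q1] and m = Q_pairsD(2)[OF Q1] and n = Q_pairsD(2)[OF Q2]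
  let ?a = "max (left_end \<mu>) (left_end \<nu>)" and ?F = "cdf (bool_max_conv \<mu> \<nu>)"
  have ratio: "cdf \<sigma> z / ?F z = cdf \<sigma> z / cdf \<mu> z + cdf \<sigma> z / cdf \<nu> z - cdf \<sigma> z"
    if "?a < z" for z
  proof -
    have p: "0 < cdf \<mu> z" "0 < cdf \<nu> z" using that left_end_props(3) m n by auto
    have "cdf \<sigma> z / ?F z = cdf \<sigma> z * odds (?F z) + cdf \<sigma> z"
      using mult_odds[OF bool_max_conv_odds(2)[OF m n p]] by simp
    then show ?thesis
      by (simp add: bool_max_conv_odds(3)[OF m n p] distrib_left mult_odds p)
  qed
  show ?thesis
  proof (rule Q_pairsI[OF s bool_max_conv_wf(1)[OF m n] left_end_bool_max_conv[OF m n]])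
    show "?F ?a = 0"
      using Q_pairsD(3)[OF Q1] Q_pairsD(3)[OF Q2]
      by (intro bool_max_conv_odds(1)[OF m n]) (auto simp: max_def)
    fix x y assume xy: "?a < x" "x \<le> y"
    have "cdf \<sigma> x \<le> cdf \<sigma> y" using monoD[OF prob_nonnegD(3)[OF s]] xy by simp
    moreover have "cdf \<sigma> y / cdf \<mu> y \<le> cdf \<sigma> x / cdf \<mu> x"
      "cdf \<sigma> y / cdf \<nu> y \<le> cdf \<sigma> x / cdf \<nu> x"
      using Q_pairsD(4)[OF Q1] Q_pairsD(4)[OF Q2] xy by auto
    ultimately show "cdf \<sigma> y / ?F y \<le> cdf \<sigma> x / ?F x" using ratio[of x] ratio[of y] xy by simp
  qed
qed

lemma U_max_bool_max_conv:
  assumes Q1: "(\<sigma>, \<mu>) \<in> Q_pairs" and Q2: "(\<sigma>, \<nu>) \<in> Q_pairs"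
  shows "U_max \<sigma> (bool_max_conv \<mu> \<nu>) = bool_max_conv (U_max \<sigma> \<mu>) (U_max \<sigma> \<nu>)"
proof (rule eq_U_maxI[symmetric, OF Q_pairs_bool_max_conv[OF Q1 Q2]])
  note m = Q_pairsD(2)[OF Q1] and n = Q_pairsD(2)[OF Q2]
  note u = U_max_wf(1)[OF Q1] and v = U_max_wf(1)[OF Q2]
  note U = U_max_odds[OF Q1] and V = U_max_odds[OF Q2]
  note e = left_end_bool_max_conv[OF m n]
  let ?R = "bool_max_conv (U_max \<sigma> \<mu>) (U_max \<sigma> \<nu>)"
  show "?R \<in> prob_nonneg" by (rule bool_max_conv_wf(1)[OF u v])
  fix x
  show "cdf ?R x = 0" if "x < left_end (bool_max_conv \<mu> \<nu>)"
    using that U(1) V(1) by (intro bool_max_conv_odds(1)[OF u v]) (auto simp: e less_max_iff_disj)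
  assume "left_end (bool_max_conv \<mu> \<nu>) < x"
  then have x: "left_end \<mu> < x" "left_end \<nu> < x" by (simp_all add: e)
  show "0 < cdf ?R x" using U(2) V(2) x by (intro bool_max_conv_odds(2)[OF u v])
  show "odds (cdf ?R x) = cdf \<sigma> x * odds (cdf (bool_max_conv \<mu> \<nu>) x)"
    using x U(2,3) V(2,3) left_end_props(3)[OF m] left_end_props(3)[OF n]
    by (simp add: bool_max_conv_odds(3)[OF u v] bool_max_conv_odds(3)[OF m n] distrib_left)
qed

lemma bool_max_power_odds:
  assumes m: "\<mu> \<in> prob_nonneg" and t: "0 < t"
  shows "cdf \<mu> x = 0 \<Longrightarrow> cdf (bool_max_power \<mu> t) x = 0"
    and "0 < cdf \<mu> x \<Longrightarrow> 0 < cdf (bool_max_power \<mu> t) x"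
    and "0 < cdf \<mu> x \<Longrightarrow> odds (cdf (bool_max_power \<mu> t) x) = t * odds (cdf \<mu> x)"
proof -
  let ?m = "cdf \<mu> x"
  note F = bool_max_power_wf(2)[OF m t]
  show "cdf (bool_max_power \<mu> t) x = 0" if "?m = 0" using that by (simp add: F)
  assume p: "0 < ?m"
  have "0 \<le> t * (1 - ?m)" using t prob_nonnegD(5)[OF m] by simp
  with p have D: "0 < t - (t - 1) * ?m" by (simp add: algebra_simps)
  show "0 < cdf (bool_max_power \<mu> t) x" using p D by (simp add: F)
  show "odds (cdf (bool_max_power \<mu> t) x) = t * odds ?m"
    using D by (simp add: F odds_divide) (simp add: odds_def algebra_simps)
qed

lemma left_end_bool_max_power:
  assumes "\<mu> \<in> prob_nonneg" "0 < t"
  shows "left_end (bool_max_power \<mu> t) = left_end \<mu>"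
  using left_end_props[OF assms(1)] bool_max_power_odds[OF assms]
  by (intro left_end_eqI[OF bool_max_power_wf(1)[OF assms]]) auto

text \<open>The ratio for the power is \<open>t * (cdf \<sigma> / cdf \<mu>) - (t - 1) * cdf \<sigma>\<close>, so \<open>1 \<le> t\<close> is what makes
  the second term antitone.\<close>

lemma Q_pairs_bool_max_power:
  assumes Q: "(\<sigma>, \<mu>) \<in> Q_pairs" and t: "1 \<le> t"
  shows "(\<sigma>, bool_max_power \<mu> t) \<in> Q_pairs"
proof -
  note s = Q_pairsD(1)[OF Q] and m = Q_pairsD(2)[OF Q]
  have t0: "0 < t" using t by simp
  let ?F = "cdf (bool_max_power \<mu> t)"
  have ratio: "cdf \<sigma> z / ?F z = t * (cdf \<sigma> z / cdf \<mu> z) - (t - 1) * cdf \<sigma> z"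
    if "left_end \<mu> < z" for z
  proof -
    have p: "0 < cdf \<mu> z" using that left_end_props(3) m by auto
    have "cdf \<sigma> z / ?F z = cdf \<sigma> z * odds (?F z) + cdf \<sigma> z"
      using mult_odds[OF bool_max_power_odds(2)[OF m t0 p]] by simp
    also have "\<dots> = t * (cdf \<sigma> z * odds (cdf \<mu> z)) + cdf \<sigma> z"
      by (simp add: bool_max_power_odds(3)[OF m t0 p])
    finally show ?thesis by (simp add: mult_odds[OF p] algebra_simps)
  qed
  show ?thesis
  proof (rule Q_pairsI[OF s bool_max_power_wf(1)[OF m t0] left_end_bool_max_power[OF m t0]])
    show "?F (left_end \<mu>) = 0" by (rule bool_max_power_odds(1)[OF m t0 Q_pairsD(3)[OF Q]])
    fix x y assume xy: "left_end \<mu> < x" "x \<le> y"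
    have "(t - 1) * cdf \<sigma> x \<le> (t - 1) * cdf \<sigma> y"
      using monoD[OF prob_nonnegD(3)[OF s]] xy t by (intro mult_left_mono) auto
    moreover have "t * (cdf \<sigma> y / cdf \<mu> y) \<le> t * (cdf \<sigma> x / cdf \<mu> x)"
      using Q_pairsD(4)[OF Q xy] t0 by (intro mult_left_mono) auto
    ultimately show "cdf \<sigma> y / ?F y \<le> cdf \<sigma> x / ?F x"
      using ratio[of x] ratio[of y] xy by linarith
  qed
qed

lemma U_max_bool_max_power:
  assumes Q: "(\<sigma>, \<mu>) \<in> Q_pairs" and t: "1 \<le> t"
  shows "U_max \<sigma> (bool_max_power \<mu> t) = bool_max_power (U_max \<sigma> \<mu>) t"
proof -
  note m = Q_pairsD(2)[OF Q] and u = U_max_wf(1)[OF Q]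
  have t0: "0 < t" using t by simp
  note e = left_end_bool_max_power[OF m t0]
  show ?thesis
    using U_max_odds[OF Q] left_end_props(3)[OF m]
    by (intro eq_U_maxI[symmetric, OF Q_pairs_bool_max_power[OF Q t] bool_max_power_wf(1)[OF u t0]])
       (simp_all add: e bool_max_power_odds[OF u t0] bool_max_power_odds(3)[OF m t0])
qed

section \<open>The diagonal case and the free square\<close>

lemma Q_pairs_diagonal:
  assumes "\<sigma> \<in> prob_nonneg" "measure \<sigma> {left_end \<sigma>} = 0"
  shows "(\<sigma>, \<sigma>) \<in> Q_pairs"
proof (rule Q_pairsI[OF assms(1) assms(1) refl])
  show "cdf \<sigma> (left_end \<sigma>) = 0" using assms(2) measure_left_end[OF assms(1)] by simp
  fix x y assume xy: "left_end \<sigma> < x" "x \<le> y"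
  then have "0 < cdf \<sigma> x" "0 < cdf \<sigma> y" using left_end_props(3)[OF assms(1)] by auto
  then show "cdf \<sigma> y / cdf \<sigma> y \<le> cdf \<sigma> x / cdf \<sigma> x" by simp
qed

text \<open>To the right of the left end point, both sides have the distribution function
  \<open>2 / (2 - cdf \<sigma>) - 1 = cdf \<sigma> / (2 - cdf \<sigma>)\<close>; to the left, the truncation at \<open>0\<close> in the
  free power makes both vanish.\<close>

lemma bool_max_square_eq_free_max_square:
  assumes s: "\<sigma> \<in> prob_nonneg" and atom: "measure \<sigma> {left_end \<sigma>} = 0"
  shows "bool_max_power \<sigma> 2 = free_max_power (U_max \<sigma> \<sigma>) 2"
proof -
  note Q = Q_pairs_diagonal[OF s atom]
  note u = U_max_wf(1)[OF Q]
  have b: "cdf (bool_max_power \<sigma> 2) = (\<lambda>x. cdf \<sigma> x / (2 - cdf \<sigma> x))"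
    using bool_max_power_wf(2)[OF s, of 2] by simp
  have f: "cdf (free_max_power (U_max \<sigma> \<sigma>) 2) = (\<lambda>x. max (2 * cdf (U_max \<sigma> \<sigma>) x - 1) 0)"
    using free_max_power_wf(2)[OF u, of 2] by simp
  show ?thesis
  proof (rule prob_nonneg_eqI_off_point[of _ _ "left_end \<sigma>"])
    show "bool_max_power \<sigma> 2 \<in> prob_nonneg" by (rule bool_max_power_wf(1)[OF s]) simp
    show "free_max_power (U_max \<sigma> \<sigma>) 2 \<in> prob_nonneg" by (rule free_max_power_wf(1)[OF u]) simp
    fix x
    show "cdf (bool_max_power \<sigma> 2) x = cdf (free_max_power (U_max \<sigma> \<sigma>) 2) x"
      if "x < left_end \<sigma>"
      using that U_max_odds(1)[OF Q] left_end_props(2)[OF s] by (simp add: b f)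
    show "cdf (bool_max_power \<sigma> 2) x = cdf (free_max_power (U_max \<sigma> \<sigma>) 2) x"
      if x: "left_end \<sigma> < x"
    proof -
      have p: "0 < cdf \<sigma> x" "cdf \<sigma> x \<le> 1" using left_end_props(3)[OF s x] prob_nonnegD(5)[OF s] .
      have "cdf \<sigma> x + cdf \<sigma> x - cdf \<sigma> x * cdf \<sigma> x = cdf \<sigma> x * (2 - cdf \<sigma> x)"
        by (simp add: algebra_simps)
      then have "cdf (U_max \<sigma> \<sigma>) x = 1 / (2 - cdf \<sigma> x)"
        using x p by (simp add: U_max_wf(2)[OF Q] U_cdf_def U_formula_def)
      moreover have "2 * (1 / (2 - cdf \<sigma> x)) - 1 = cdf \<sigma> x / (2 - cdf \<sigma> x)"
        using p by (simp add: field_simps)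
      moreover have "0 \<le> cdf \<sigma> x / (2 - cdf \<sigma> x)" using p by simp
      ultimately show ?thesis unfolding b f by simp
    qed
  qed
qed

section \<open>The four identities\<close>

theorem theorem1p5:
  shows
    "(\<forall>\<sigma>\<^sub>1\<in>prob_nonneg. \<forall>\<sigma>\<^sub>2\<in>prob_nonneg. \<forall>\<mu>\<in>prob_nonneg.
        (max_conv \<sigma>\<^sub>1 \<sigma>\<^sub>2, \<mu>) \<in> Q_pairs \<longrightarrow>
          (\<sigma>\<^sub>1, \<mu>) \<in> Q_pairs \<and> (\<sigma>\<^sub>2, \<mu>) \<in> Q_pairs \<and>
          ((\<sigma>\<^sub>1, U_max \<sigma>\<^sub>2 \<mu>) \<in> Q_pairs \<longrightarrow>
             (U_max \<sigma>\<^sub>1 \<circ> U_max \<sigma>\<^sub>2) \<mu> = U_max (max_conv \<sigma>\<^sub>1 \<sigma>\<^sub>2) \<mu>))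
   \<and> (\<forall>\<sigma>\<in>prob_nonneg. \<forall>\<mu>\<^sub>1\<in>prob_nonneg. \<forall>\<mu>\<^sub>2\<in>prob_nonneg.
        (\<sigma>, \<mu>\<^sub>1) \<in> Q_pairs \<and> (\<sigma>, \<mu>\<^sub>2) \<in> Q_pairs \<longrightarrow>
          (\<sigma>, bool_max_conv \<mu>\<^sub>1 \<mu>\<^sub>2) \<in> Q_pairs \<and>
          U_max \<sigma> (bool_max_conv \<mu>\<^sub>1 \<mu>\<^sub>2) = bool_max_conv (U_max \<sigma> \<mu>\<^sub>1) (U_max \<sigma> \<mu>\<^sub>2))
   \<and> (\<forall>\<sigma>\<in>prob_nonneg. \<forall>\<mu>\<in>prob_nonneg. \<forall>t\<ge>1.
        (\<sigma>, \<mu>) \<in> Q_pairs \<longrightarrow>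
          (\<sigma>, bool_max_power \<mu> t) \<in> Q_pairs \<and>
          U_max \<sigma> (bool_max_power \<mu> t) = bool_max_power (U_max \<sigma> \<mu>) t)
   \<and> (\<forall>\<sigma>\<in>prob_nonneg. measure \<sigma> {left_end \<sigma>} = 0 \<longrightarrow>
        bool_max_power \<sigma> 2 = free_max_power (U_max \<sigma> \<sigma>) 2)"
proof (intro conjI ballI allI impI)
  fix \<sigma>\<^sub>1 \<sigma>\<^sub>2 \<mu> :: "real measure"
  assume s: "\<sigma>\<^sub>1 \<in> prob_nonneg" "\<sigma>\<^sub>2 \<in> prob_nonneg" and Q: "(max_conv \<sigma>\<^sub>1 \<sigma>\<^sub>2, \<mu>) \<in> Q_pairs"
  show "(\<sigma>\<^sub>1, \<mu>) \<in> Q_pairs" by (rule Q_pairs_max_conv_factor[OF s Q])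
  show Q2: "(\<sigma>\<^sub>2, \<mu>) \<in> Q_pairs"
    by (rule Q_pairs_max_conv_factor[OF s(2,1) Q[unfolded max_conv_commute[of \<sigma>\<^sub>1]]])
  show "(U_max \<sigma>\<^sub>1 \<circ> U_max \<sigma>\<^sub>2) \<mu> = U_max (max_conv \<sigma>\<^sub>1 \<sigma>\<^sub>2) \<mu>"
    if "(\<sigma>\<^sub>1, U_max \<sigma>\<^sub>2 \<mu>) \<in> Q_pairs"
    using U_max_max_conv[OF s Q Q2 that] by simp
qed (auto intro: Q_pairs_bool_max_conv U_max_bool_max_conv Q_pairs_bool_max_power
      U_max_bool_max_power bool_max_square_eq_free_max_square)

end
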